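(* Let $D$ be a Pr\"ufer domain. If an amount $D$-algebra $B$ (with amount function $A: B\to\mathrm{Id}(D)$ and function $\epsilon:\mathrm{Id}(D)\to\mathrm{Id}(B)$, $I\mapsto I^\epsilon$) is Gaussian, then $\omega_B(I^{\epsilon})=\omega_D(I)$ for each ideal $I$ of $D$. In particular, if $I$ is an ideal of a Dedekind domain $D$, then $$\omega_{D[[X]]}(I[[X]])=\omega_{D[X]}(I[X])=\omega_D(I).$$
   Context: All rings are commutative with identity and all algebras are unitary (and commutative). $\mathrm{Id}(R)$ denotes the set of all ideals of a ring $R$; $J^0=R$ for an ideal $J$ of $R$. $X$ is an indeterminate; $I[X]$ (resp. $I[[X]]$) denotes the ideal of the polynomial ring $D[X]$ (resp. of the power series ring $D[[X]]$) consisting of all elements whose coefficients all lie in $I$. Amount function: for an $R$-algebra $B$, a function $A: B\to\mathrm{Id}(R)$, $f\mapsto A_f$, is an amount function if for all $r\in R$ and $f,g\in B$: (1) $A_0=(0)$ and $A_1=R$; (2) $A_f=(0)$ implies $f=0$; (3) $A_{rf}=rA_f$; (4) $A_{fg}\subseteq A_fA_g$. Amount algebra: an $R$-algebra $B$ is an amount $R$-algebra if (1) there is an amount function $A:B\to\mathrm{Id}(R)$ such that for all $f,g\in B$ there are non-negative integers $m,n$ with $A_f^mA_g^nA_{fg}=A_f^{m+1}A_g^{n+1}$; and (2) there is a function $\epsilon:\mathrm{Id}(R)\to\mathrm{Id}(B)$, $I\mapsto I^{\epsilon}$, such that (a) $A_f\subseteq I$ if and only if $f\in I^{\epsilon}$,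 for all $f\in B$ and $I\in\mathrm{Id}(R)$, and (b) $I^{\epsilon}\cap R=I$ for all $I\in\mathrm{Id}(R)$ (where $I^\epsilon\cap R$ is the preimage of $I^\epsilon$ under the structure map $R\to B$). Gaussian: an amount $R$-algebra $B$ (with amount function $A$) is Gaussian if $A_{fg}=A_fA_g$ for all $f,g\in B$. Absorbing ideals: for a positive integer $n$, a proper ideal $I$ of $R$ is $n$-absorbing if whenever $r_1\cdots r_{n+1}\in I$ with $r_1,\ldots,r_{n+1}\in R$, there are $n$ of the $r_i$'s whose product is in $I$. If $I$ is $n$-absorbing for some positive integer $n$, then $\omega_R(I)=\min\{n : I \text{ is an } n\text{-absorbing ideal of } R\}$; otherwise $\omega_R(I)=\infty$. *)

theory Defs
  imports
    "HOL-Library.Extended_Nat"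
    "HOL-Computational_Algebra.Computational_Algebra"
begin

section \<open>Ideals\<close>

text \<open>The ideals of a commutative ring are its submodules as a module over itself:
  \<open>ideal.subspace I\<close> says that \<open>I\<close> is an ideal, \<open>ideal.span S\<close> is the ideal generated by \<open>S\<close>.\<close>

global_interpretation ideal: module "times :: 'a::comm_ring_1 \<Rightarrow> 'a \<Rightarrow> 'a"
  by unfold_locales (simp_all add: algebra_simps)

text \<open>As a simplification rule this would loop with associativity of multiplication.\<close>

declare ideal.scale_scale [simp del]

definition ideal_mult :: "'a::comm_ring_1 set \<Rightarrow> 'a set \<Rightarrow> 'a set" where
  "ideal_mult I J = ideal.span {a * b | a b. a \<in> I \<and> b \<in> J}"

primrec ideal_power :: "'a::comm_ring_1 set \<Rightarrow> nat \<Rightarrow> 'a set" where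
  "ideal_power I 0 = UNIV"
| "ideal_power I (Suc n) = ideal_mult I (ideal_power I n)"

definition fin_gen_ideal :: "'a::comm_ring_1 set \<Rightarrow> bool" where
  "fin_gen_ideal I \<longleftrightarrow> (\<exists>S. finite S \<and> I = ideal.span S)"

definition proper_ideal :: "'a::comm_ring_1 set \<Rightarrow> bool" where
  "proper_ideal I \<longleftrightarrow> ideal.subspace I \<and> I \<noteq> UNIV"

definition prime_ideal :: "'a::comm_ring_1 set \<Rightarrow> bool" where
  "prime_ideal P \<longleftrightarrow> proper_ideal P \<and> (\<forall>a b. a * b \<in> P \<longrightarrow> a \<in> P \<or> b \<in> P)"

definition maximal_ideal :: "'a::comm_ring_1 set \<Rightarrow> bool" where
  "maximal_ideal M \<longleftrightarrow>
     proper_ideal M \<and> (\<forall>J. ideal.subspace J \<and> M \<subseteq> J \<longrightarrow> J = M \<or> J = UNIV)"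


section \<open>Pruefer domains and Dedekind domains\<close>

text \<open>The fraction field \<open>'a fract\<close> as a module over \<open>'a\<close>.\<close>

global_interpretation fract: module "\<lambda>(d::'a::idom) (x::'a fract). to_fract d * x"
  by unfold_locales (simp_all add: algebra_simps)

declare fract.scale_scale [simp del]

definition ideal_inverse :: "'a::idom set \<Rightarrow> 'a fract set" where
  "ideal_inverse J = {x. \<forall>a\<in>J. to_fract a * x \<in> range to_fract}"

definition invertible_ideal :: "'a::idom set \<Rightarrow> bool" where
  "invertible_ideal J \<longleftrightarrow>
     fract.span {to_fract a * x | a x. a \<in> J \<and> x \<in> ideal_inverse J} = range to_fract"

definition prufer_domain :: "'a::idom itself \<Rightarrow> bool" where
  "prufer_domain _ \<longleftrightarrow>
     (\<forall>J :: 'a set. fin_gen_ideal J \<and> J \<noteq> {0} \<longrightarrow> invertible_ideal J)"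

definition noetherian :: "'a::comm_ring_1 itself \<Rightarrow> bool" where
  "noetherian _ \<longleftrightarrow> (\<forall>J :: 'a set. ideal.subspace J \<longrightarrow> fin_gen_ideal J)"

definition integrally_closed :: "'a::idom itself \<Rightarrow> bool" where
  "integrally_closed _ \<longleftrightarrow>
     (\<forall>x :: 'a fract. (\<exists>p :: 'a poly. lead_coeff p = 1 \<and> poly (map_poly to_fract p) x = 0)
        \<longrightarrow> x \<in> range to_fract)"

text \<open>As is usual in multiplicative ideal theory, fields count as Dedekind domains
  (and, by the definition above, as Pruefer domains).\<close>

definition dedekind_domain :: "'a::idom itself \<Rightarrow> bool" where
  "dedekind_domain D \<longleftrightarrow> noetherian D \<and> integrally_closed D \<and>
     (\<forall>P :: 'a set. prime_ideal P \<and> P \<noteq> {0} \<longrightarrow> maximal_ideal P)"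


section \<open>Amount algebras\<close>

locale comm_algebra = module scale
  for scale :: "'r::comm_ring_1 \<Rightarrow> 'b::comm_ring_1 \<Rightarrow> 'b" (infixr \<open>*s\<close> 75) +
  assumes scale_mult_left: "(r *s x) * y = r *s (x * y)"

locale amount_function = comm_algebra scale
  for scale :: "'r::comm_ring_1 \<Rightarrow> 'b::comm_ring_1 \<Rightarrow> 'b" (infixr \<open>*s\<close> 75)
    and A :: "'b \<Rightarrow> 'r set" +
  assumes amount_ideal: "ideal.subspace (A f)"
    and amount_zero: "A 0 = {0}"
    and amount_one: "A 1 = UNIV"
    and amount_eq_zeroD: "A f = {0} \<Longrightarrow> f = 0"
    and amount_scale: "A (r *s f) = (\<lambda>a. r * a) ` A f"
    and amount_mult_subset: "A (f * g) \<subseteq> ideal_mult (A f) (A g)"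

text \<open>\<open>eps\<close> only matters on ideals. The structure map is \<open>r \<mapsto> r *s 1\<close>, so the last assumption
  says that \<open>I\<close> is the contraction of \<open>eps I\<close>.\<close>

locale amount_algebra = amount_function scale A
  for scale :: "'r::comm_ring_1 \<Rightarrow> 'b::comm_ring_1 \<Rightarrow> 'b" (infixr \<open>*s\<close> 75)
    and A :: "'b \<Rightarrow> 'r set"
    and eps :: "'r set \<Rightarrow> 'b set" +
  assumes amount_exponents:
      "\<exists>m n. ideal_mult (ideal_mult (ideal_power (A f) m) (ideal_power (A g) n)) (A (f * g))
           = ideal_mult (ideal_power (A f) (m + 1)) (ideal_power (A g) (n + 1))"
    and eps_ideal: "ideal.subspace I \<Longrightarrow> ideal.subspace (eps I)"
    and amount_subset_iff: "ideal.subspace I \<Longrightarrow> A f \<subseteq> I \<longleftrightarrow> f \<in> eps I"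
    and eps_contraction: "ideal.subspace I \<Longrightarrow> {r. r *s 1 \<in> eps I} = I"

locale gaussian_amount_algebra = amount_algebra scale A eps
  for scale :: "'r::comm_ring_1 \<Rightarrow> 'b::comm_ring_1 \<Rightarrow> 'b" (infixr \<open>*s\<close> 75)
    and A :: "'b \<Rightarrow> 'r set"
    and eps :: "'r set \<Rightarrow> 'b set" +
  assumes amount_mult: "A (f * g) = ideal_mult (A f) (A g)"


section \<open>Absorbing ideals\<close>

definition absorbing_ideal :: "nat \<Rightarrow> 'a::comm_ring_1 set \<Rightarrow> bool" where
  "absorbing_ideal n I \<longleftrightarrow> n \<ge> 1 \<and> proper_ideal I \<and>
     (\<forall>r :: nat \<Rightarrow> 'a. (\<Prod>i\<in>{1..n+1}. r i) \<in> I
        \<longrightarrow> (\<exists>N \<subseteq> {1..n+1}. card N = n \<and> (\<Prod>i\<in>N. r i) \<in> I))"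

text \<open>In particular \<open>absorbing_number UNIV = \<infinity>\<close>, as the unit ideal is not absorbing.\<close>

definition absorbing_number :: "'a::comm_ring_1 set \<Rightarrow> enat" where
  "absorbing_number I =
     (if \<exists>n. absorbing_ideal n I then enat (LEAST n. absorbing_ideal n I) else \<infinity>)"


section \<open>Extension of ideals to polynomials and power series\<close>

definition poly_ideal :: "'a::comm_ring_1 set \<Rightarrow> 'a poly set" where
  "poly_ideal I = {p. \<forall>n. coeff p n \<in> I}"

definition fps_ideal :: "'a::comm_ring_1 set \<Rightarrow> 'a fps set" where
  "fps_ideal I = {f. \<forall>n. fps_nth f n \<in> I}"

end

theory Submission
  imports Defs
begin

text \<open>If \<open>eps I\<close> is \<open>n\<close>-absorbing, so is its contraction \<open>I\<close>, because the structure map is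
  multiplicative. The converse is the point. For a Gaussian amount, a product of
  \<open>f i\<close> lies in \<open>eps I\<close> iff \<open>I\<close> contains the product of the ideals \<open>A (f i)\<close>; so one needs that \<open>I\<close>
  absorbs not only products of elements but also products of ideals.

  Over a Pruefer domain it does (\<open>prufer_domain_absorbing_ideals\<close>). A failure is witnessed by finitely
  many elements, hence by finitely generated ideals, and by finitely many maximal ideals.
  Finitely generated ideals are invertible, so each has one element generating it locally at all of
  these maximal ideals (\<open>prufer_domain_local_generator\<close>). Near the relevant maximal ideals, products
  of ideals are thus products of elements, which \<open>I\<close> absorbs.

  A Dedekind domain is a Pruefer domain: were the product of a nonzero ideal \<open>J\<close> and its inverse
  inside a maximal ideal \<open>M\<close>, the elements of the inverse of \<open>M\<close> would be almost integral, hence in the domain, but that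
  inverse is strictly larger than the domain. Over it, polynomials and power series are
  Gaussian amount algebras with the content as amount (\<open>content_ideal_mult\<close>), because locally any
  content is principal and the product of two primitive series is primitive. So the general result
  applies to both.\<close>


section \<open>Ideals, maximal and prime\<close>

lemma ideal_one_iff: "ideal.subspace (I :: 'a::comm_ring_1 set) \<Longrightarrow> 1 \<in> I \<longleftrightarrow> I = UNIV"
  by (metis UNIV_I UNIV_eq_I ideal.subspace_scale mult.right_neutral)

lemma ideal_colon: "ideal.subspace (I :: 'a::comm_ring_1 set) \<Longrightarrow> ideal.subspace {r. r * b \<in> I}"
  by (rule ideal.subspaceI)
     (auto simp: ring_distribs mult.assoc intro: ideal.subspace_0 ideal.subspace_add ideal.subspace_scale)

lemma ideal_Union_chain:
  fixes \<C> :: "'a::comm_ring_1 set set"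
  assumes "\<C> \<noteq> {}" "subset.chain \<A> \<C>" "\<And>I. I \<in> \<A> \<Longrightarrow> ideal.subspace I"
  shows "ideal.subspace (\<Union>\<C>)"
proof (rule ideal.subspaceI)
  have sub: "\<And>I. I \<in> \<C> \<Longrightarrow> ideal.subspace I"
    using assms by (auto simp: subset_chain_def)
  show "0 \<in> \<Union>\<C>"
    using \<open>\<C> \<noteq> {}\<close> sub by (auto intro: ideal.subspace_0)
  show "c * x \<in> \<Union>\<C>" if "x \<in> \<Union>\<C>" for c x
    using that sub by (auto intro: ideal.subspace_scale)
  show "x + y \<in> \<Union>\<C>" if xy: "x \<in> \<Union>\<C>" "y \<in> \<Union>\<C>" for x y
  proof -
    obtain B where "B \<in> \<C>" "{x, y} \<subseteq> B"
      using finite_subset_Union_chain[of "{x, y}" \<C> \<A>] assms xy by auto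
    then show ?thesis
      using sub by (auto intro: ideal.subspace_add)
  qed
qed

lemma ex_maximal_ideal_superset:
  fixes I :: "'a::comm_ring_1 set"
  assumes "ideal.subspace I" "I \<noteq> UNIV"
  shows "\<exists>M. maximal_ideal M \<and> I \<subseteq> M"
proof -
  define \<A> where "\<A> = {J :: 'a set. ideal.subspace J \<and> 1 \<notin> J \<and> I \<subseteq> J}"
  have "\<exists>M\<in>\<A>. \<forall>X\<in>\<A>. M \<subseteq> X \<longrightarrow> X = M"
  proof (rule subset_Zorn_nonempty)
    show "\<A> \<noteq> {}"
      using assms ideal_one_iff[of I] by (auto simp: \<A>_def)
    show "\<Union>\<C> \<in> \<A>" if C: "\<C> \<noteq> {}" "subset.chain \<A> \<C>" for \<C>
    proof -
      have "\<C> \<subseteq> \<A>"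
        using C by (auto simp: subset_chain_def)
      moreover have "ideal.subspace (\<Union>\<C>)"
        using C by (rule ideal_Union_chain) (auto simp: \<A>_def)
      moreover have "I \<subseteq> \<Union>\<C>"
        using \<open>\<C> \<noteq> {}\<close> \<open>\<C> \<subseteq> \<A>\<close> unfolding \<A>_def by blast
      moreover have "1 \<notin> \<Union>\<C>"
        using \<open>\<C> \<subseteq> \<A>\<close> unfolding \<A>_def by blast
      ultimately show ?thesis
        unfolding \<A>_def by simp
    qed
  qed
  then obtain M where M: "M \<in> \<A>" "\<And>X. X \<in> \<A> \<Longrightarrow> M \<subseteq> X \<Longrightarrow> X = M"
    by blast
  have "J = M \<or> J = UNIV" if "ideal.subspace J" "M \<subseteq> J" for J
    using that M ideal_one_iff[of J] by (auto simp: \<A>_def)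
  then show ?thesis
    using M(1) unfolding maximal_ideal_def proper_ideal_def \<A>_def by blast
qed

lemma prime_ideal_one: "prime_ideal P \<Longrightarrow> 1 \<notin> P"
  using ideal_one_iff[of P] by (auto simp: prime_ideal_def proper_ideal_def)

lemma maximal_ideal_imp_prime:
  assumes M: "maximal_ideal M"
  shows "prime_ideal M"
proof -
  have sub: "ideal.subspace M" and "M \<noteq> UNIV"
    using M by (auto simp: maximal_ideal_def proper_ideal_def)
  have "b \<in> M" if ab: "a * b \<in> M" "a \<notin> M" for a b
  proof -
    have "M \<subseteq> {r. r * b \<in> M}"
      using ideal.subspace_scale[OF sub] by (auto simp: mult.commute)
    then have "{r. r * b \<in> M} = UNIV"
      using M ideal_colon[OF sub, of b] ab unfolding maximal_ideal_def by blast
    then have "1 * b \<in> M"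
      by blast
    then show ?thesis
      by simp
  qed
  then show ?thesis
    using sub \<open>M \<noteq> UNIV\<close> unfolding prime_ideal_def proper_ideal_def by blast
qed

lemma prime_ideal_prod:
  assumes P: "prime_ideal P" and "finite X" "(\<Prod>x\<in>X. f x) \<in> P"
  shows "\<exists>x\<in>X. f x \<in> P"
  using assms(2,3)
proof (induction X rule: finite_induct)
  case empty
  then show ?case
    using prime_ideal_one[OF P] by simp
next
  case (insert x X)
  then show ?case
    using P by (auto simp: prime_ideal_def)
qed

lemma ideal_prod_mem:
  fixes I :: "'a::comm_ring_1 set"
  assumes "ideal.subspace I" "finite X" "x \<in> X" "f x \<in> I"
  shows "(\<Prod>x\<in>X. f x) \<in> I"
  using assms ideal.subspace_scale[of I "f x" "prod f (X - {x})"]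
  by (simp add: prod.remove[of X x] mult.commute)

lemma maximal_ideals_avoidance:
  fixes F :: "'a::comm_ring_1 set set"
  assumes "finite F" and max: "\<And>N. N \<in> F \<Longrightarrow> maximal_ideal N" and "M \<in> F"
  shows "\<exists>e. e \<notin> M \<and> (\<forall>N\<in>F - {M}. e \<in> N)"
proof -
  have "\<forall>N\<in>F - {M}. \<exists>d. d \<in> N \<and> d \<notin> M"
    using max \<open>M \<in> F\<close> unfolding maximal_ideal_def proper_ideal_def by blast
  then obtain d where d: "\<And>N. N \<in> F - {M} \<Longrightarrow> d N \<in> N \<and> d N \<notin> M"
    by metis
  have "(\<Prod>N\<in>F - {M}. d N) \<notin> M"
    using prime_ideal_prod[OF maximal_ideal_imp_prime[OF max[OF \<open>M \<in> F\<close>]], of "F - {M}" d]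
      d \<open>finite F\<close> by auto
  moreover have "(\<Prod>N\<in>F - {M}. d N) \<in> N" if "N \<in> F - {M}" for N
    using d that max[of N] \<open>finite F\<close>
    by (intro ideal_prod_mem[of N "F - {M}" N d]) (auto simp: maximal_ideal_def proper_ideal_def)
  ultimately show ?thesis
    by blast
qed


section \<open>Invertible ideals are principal at finitely many maximal ideals\<close>

lemma ideal_inverseD: "x \<in> ideal_inverse J \<Longrightarrow> a \<in> J \<Longrightarrow> \<exists>d. to_fract a * x = to_fract d"
  by (auto simp: ideal_inverse_def)

text \<open>The products \<open>a x\<close> generate the whole ring, so they cannot all lie in \<open>M\<close>. An \<open>a\<close> with
  \<open>a x \<notin> M\<close> generates \<open>J\<close> in the localization at \<open>M\<close>: any \<open>b \<in> J\<close> satisfies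
  \<open>(a x) b = a (x b)\<close>, where \<open>a x\<close> is a unit at \<open>M\<close> and \<open>x b\<close> is in the ring.\<close>

lemma invertible_ideal_unit_at:
  fixes J M :: "'a::idom set"
  assumes inv: "invertible_ideal J" and M: "maximal_ideal M"
  shows "\<exists>a x s. a \<in> J \<and> x \<in> ideal_inverse J \<and> s \<notin> M \<and> to_fract a * x = to_fract s"
proof (rule ccontr)
  assume no: "\<not> ?thesis"
  have sub: "ideal.subspace M"
    using M by (auto simp: maximal_ideal_def proper_ideal_def)
  have "fract.subspace (to_fract ` M)"
  proof (rule fract.subspaceI)
    show "0 \<in> to_fract ` M"
      using ideal.subspace_0[OF sub] by (metis imageI to_fract_0)
    show "x + y \<in> to_fract ` M" if "x \<in> to_fract ` M" "y \<in> to_fract ` M" for x y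
      using that ideal.subspace_add[OF sub] by (auto simp flip: to_fract_add)
    show "to_fract c * x \<in> to_fract ` M" if "x \<in> to_fract ` M" for c x
      using that ideal.subspace_scale[OF sub] by (auto simp flip: to_fract_mult)
  qed
  moreover have "{to_fract a * x | a x. a \<in> J \<and> x \<in> ideal_inverse J} \<subseteq> to_fract ` M"
  proof clarify
    fix a x assume ax: "a \<in> J" "x \<in> ideal_inverse J"
    then obtain s where "to_fract a * x = to_fract s"
      using ideal_inverseD by blast
    then show "to_fract a * x \<in> to_fract ` M"
      using no ax by auto
  qed
  ultimately have "range to_fract \<subseteq> to_fract ` M"
    using fract.span_minimal inv[unfolded invertible_ideal_def] by blast
  then have "to_fract 1 \<in> to_fract ` M"
    by blast
  then have "1 \<in> M"
    by (metis imageE to_fract_eq_iff)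
  then show False
    using prime_ideal_one[OF maximal_ideal_imp_prime[OF M]] by simp
qed

text \<open>A single \<open>a\<close> generates \<open>J\<close> locally at every \<open>M \<in> F\<close>: weight the local generators by elements
  that lie in all maximal ideals of \<open>F\<close> but one.\<close>

lemma prufer_domain_local_generator:
  fixes J :: "'a::idom set"
  assumes prufer: "prufer_domain TYPE('a)" and fg: "fin_gen_ideal J"
    and fin: "finite F" and max: "\<And>M. M \<in> F \<Longrightarrow> maximal_ideal M"
  shows "\<exists>a\<in>J. \<forall>M\<in>F. \<exists>s. s \<notin> M \<and> (\<forall>b\<in>J. \<exists>d. s * b = a * d)"
proof (cases "J = {0}")
  case True
  have "1 \<notin> M" if "M \<in> F" for M
    using prime_ideal_one[OF maximal_ideal_imp_prime[OF max[OF that]]] .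
  then show ?thesis
    using True by auto
next
  case False
  have subJ: "ideal.subspace J"
    using fg by (auto simp: fin_gen_ideal_def)
  have inv: "invertible_ideal J"
    using prufer fg False unfolding prufer_domain_def by blast
  then have "\<forall>M\<in>F. \<exists>a x s. a \<in> J \<and> x \<in> ideal_inverse J \<and> s \<notin> M \<and> to_fract a * x = to_fract s"
    using invertible_ideal_unit_at max by blast
  then obtain a x s where axs: "\<And>M. M \<in> F \<Longrightarrow> a M \<in> J \<and> x M \<in> ideal_inverse J \<and> s M \<notin> M \<and>
      to_fract (a M) * x M = to_fract (s M)"
    by metis
  obtain e where e: "\<And>M. M \<in> F \<Longrightarrow> e M \<notin> M \<and> (\<forall>N\<in>F - {M}. e M \<in> N)"
    using maximal_ideals_avoidance[OF fin max] by metis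
  define c where "c = (\<Sum>M\<in>F. e M * a M)"
  have cJ: "c \<in> J"
    unfolding c_def using axs by (intro ideal.subspace_sum[OF subJ] ideal.subspace_scale[OF subJ]) auto
  have "\<exists>t. t \<notin> M \<and> (\<forall>b\<in>J. \<exists>d. t * b = c * d)" if MF: "M \<in> F" for M
  proof -
    have sub: "ideal.subspace M" and prime: "prime_ideal M"
      using max[OF MF] maximal_ideal_imp_prime by (auto simp: maximal_ideal_def proper_ideal_def)
    have "\<forall>N\<in>F. \<exists>k. to_fract (a N) * x M = to_fract k"
      using ideal_inverseD axs MF by blast
    then obtain k where k: "\<And>N. N \<in> F \<Longrightarrow> to_fract (a N) * x M = to_fract (k N)"
      by metis
    have kM: "k M = s M"
      using k[OF MF] axs[OF MF] by (metis to_fract_eq_iff)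
    \<comment> \<open>In \<open>t = c x\<close> all summands but the unit \<open>e M * s M\<close> vanish modulo \<open>M\<close>.\<close>
    define t where "t = (\<Sum>N\<in>F. e N * k N)"
    have ct: "to_fract c * x M = to_fract t"
      unfolding c_def t_def to_fract_sum sum_distrib_right to_fract_mult
      by (intro sum.cong refl) (simp add: k mult.assoc)
    have "(\<Sum>N\<in>F - {M}. e N * k N) \<in> M"
    proof (intro ideal.subspace_sum[OF sub])
      fix N assume "N \<in> F - {M}"
      then have "e N \<in> M"
        using e[of N] MF by auto
      then show "e N * k N \<in> M"
        using ideal.subspace_scale[OF sub, of "e N" "k N"] by (simp add: mult.commute)
    qed
    moreover have "e M * k M \<notin> M"
      using prime e[OF MF] axs[OF MF] kM by (auto simp: prime_ideal_def)
    moreover have "t = e M * k M + (\<Sum>N\<in>F - {M}. e N * k N)"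
      unfolding t_def using fin MF by (simp add: sum.remove)
    ultimately have "t \<notin> M"
      using ideal.subspace_diff[OF sub, of t "\<Sum>N\<in>F - {M}. e N * k N"] by auto
    moreover have "\<exists>d. t * b = c * d" if bJ: "b \<in> J" for b
    proof -
      obtain d where "to_fract b * x M = to_fract d"
        using ideal_inverseD axs[OF MF] bJ by blast
      then have "to_fract (t * b) = to_fract (c * d)"
        by (simp add: ct[symmetric] ac_simps)
      then show ?thesis
        by (metis to_fract_eq_iff)
    qed
    ultimately show ?thesis
      by blast
  qed
  then show ?thesis
    using cJ by blast
qed


section \<open>Absorbing ideals of a Pruefer domain absorb products of ideals\<close>

lemma subset_omit_one:
  assumes "N \<subseteq> {1..n + 1::nat}" "card N = n"
  shows "\<exists>i\<in>{1..n + 1}. N = {1..n + 1} - {i}"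
proof -
  have "card ({1..n + 1} - N) = 1"
    using assms by (simp add: card_Diff_subset finite_subset)
  then obtain i where "{1..n + 1} - N = {i}"
    by (auto simp: card_1_singleton_iff)
  then show ?thesis
    using assms(1) by blast
qed

lemma absorbing_ideal_omit_one:
  "absorbing_ideal n I \<longleftrightarrow> n \<ge> 1 \<and> proper_ideal I \<and>
     (\<forall>r. (\<Prod>i\<in>{1..n+1}. r i) \<in> I \<longrightarrow> (\<exists>i\<in>{1..n+1}. (\<Prod>j\<in>{1..n+1} - {i}. r j) \<in> I))"
proof -
  have "(\<exists>N\<subseteq>{1..n+1}. card N = n \<and> (\<Prod>i\<in>N. r i) \<in> I)
      \<longleftrightarrow> (\<exists>i\<in>{1..n+1}. (\<Prod>j\<in>{1..n+1} - {i}. r j) \<in> I)" for r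
  proof
    assume "\<exists>N\<subseteq>{1..n+1}. card N = n \<and> (\<Prod>i\<in>N. r i) \<in> I"
    then show "\<exists>i\<in>{1..n+1}. (\<Prod>j\<in>{1..n+1} - {i}. r j) \<in> I"
      using subset_omit_one by metis
  next
    assume "\<exists>i\<in>{1..n+1}. (\<Prod>j\<in>{1..n+1} - {i}. r j) \<in> I"
    then obtain i where "i \<in> {1..n+1}" "(\<Prod>j\<in>{1..n+1} - {i}. r j) \<in> I"
      by blast
    then show "\<exists>N\<subseteq>{1..n+1}. card N = n \<and> (\<Prod>i\<in>N. r i) \<in> I"
      by (intro exI[of _ "{1..n+1} - {i}"]) auto
  qed
  then show ?thesis
    unfolding absorbing_ideal_def by blast
qed

text \<open>Suppose that for each \<open>i\<close> some product \<open>\<Prod>j\<noteq>i. b i j\<close> with \<open>b i j \<in> S j\<close> is not in \<open>I\<close>. The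
  elements multiplying it into \<open>I\<close> form a proper ideal, contained in a maximal ideal \<open>M i\<close>. Choosing
  \<open>a j\<close> in the ideal generated by the \<open>b i j\<close> so that it generates this ideal locally at all
  the \<open>M i\<close> at once turns products of ideals into products of elements: as \<open>I\<close> absorbs
  \<open>\<Prod>j. a j\<close>, it contains \<open>\<Prod>j\<noteq>i. a j\<close> for some \<open>i\<close>, hence locally at \<open>M i\<close> also
  \<open>\<Prod>j\<noteq>i. b i j\<close>, which contradicts the choice of \<open>M i\<close>.

  That \<open>I\<close> contains a product of ideals is expressed by its containing all products of their
  elements, so that \<open>b\<close> can be chosen directly.\<close>

lemma prufer_domain_absorbing_ideals:
  fixes I :: "'a::idom set" and S :: "nat \<Rightarrow> 'a set"
  assumes prufer: "prufer_domain TYPE('a)" and abs: "absorbing_ideal n I"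
    and S: "\<And>j. ideal.subspace (S j)"
    and prod: "\<And>c. (\<And>j. j \<in> {1..n+1} \<Longrightarrow> c j \<in> S j) \<Longrightarrow> (\<Prod>j\<in>{1..n+1}. c j) \<in> I"
  shows "\<exists>i\<in>{1..n+1}. \<forall>c. (\<forall>j\<in>{1..n+1} - {i}. c j \<in> S j) \<longrightarrow> (\<Prod>j\<in>{1..n+1} - {i}. c j) \<in> I"
proof (rule ccontr)
  define K where "K = {1..n+1}"
  have "finite K"
    by (simp add: K_def)
  assume "\<not> ?thesis"
  then have "\<forall>i\<in>K. \<exists>c. (\<forall>j\<in>K - {i}. c j \<in> S j) \<and> (\<Prod>j\<in>K - {i}. c j) \<notin> I"
    by (auto simp: K_def)
  then obtain b where b: "\<And>i j. i \<in> K \<Longrightarrow> j \<in> K - {i} \<Longrightarrow> b i j \<in> S j"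
      "\<And>i. i \<in> K \<Longrightarrow> (\<Prod>j\<in>K - {i}. b i j) \<notin> I"
    by metis
  have sub: "ideal.subspace I"
    using abs by (auto simp: absorbing_ideal_def proper_ideal_def)
  have "\<exists>M. maximal_ideal M \<and> {r. r * (\<Prod>j\<in>K - {i}. b i j) \<in> I} \<subseteq> M" if "i \<in> K" for i
  proof (rule ex_maximal_ideal_superset)
    show "ideal.subspace {r. r * (\<Prod>j\<in>K - {i}. b i j) \<in> I}"
      using sub by (rule ideal_colon)
    have "1 \<notin> {r. r * (\<Prod>j\<in>K - {i}. b i j) \<in> I}"
      using b(2)[OF that] by simp
    then show "{r. r * (\<Prod>j\<in>K - {i}. b i j) \<in> I} \<noteq> UNIV"
      by blast
  qed
  then obtain M where M: "\<And>i. i \<in> K \<Longrightarrow> maximal_ideal (M i)"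
      "\<And>i r. i \<in> K \<Longrightarrow> r * (\<Prod>j\<in>K - {i}. b i j) \<in> I \<Longrightarrow> r \<in> M i"
    by (metis (no_types, lifting) mem_Collect_eq subsetD)
  define J where "J j = ideal.span ((\<lambda>i. b i j) ` (K - {j}))" for j
  have "fin_gen_ideal (J j)" for j
    unfolding fin_gen_ideal_def J_def using \<open>finite K\<close> by (intro exI[of _ "(\<lambda>i. b i j) ` (K - {j})"]) simp
  then have "\<exists>a\<in>J j. \<forall>N\<in>M ` K. \<exists>s. s \<notin> N \<and> (\<forall>b\<in>J j. \<exists>d. s * b = a * d)" for j
    using M(1) \<open>finite K\<close> by (intro prufer_domain_local_generator prufer) auto
  then obtain a where a: "\<And>j. a j \<in> J j"
      "\<And>j i. i \<in> K \<Longrightarrow> \<exists>s. s \<notin> M i \<and> (\<forall>b\<in>J j. \<exists>d. s * b = a j * d)"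
    by (metis imageI)
  have "J j \<subseteq> S j" if "j \<in> K" for j
    unfolding J_def using that b(1) by (intro ideal.span_minimal S) auto
  then have "(\<Prod>j\<in>K. a j) \<in> I"
    using a(1) prod[of a] unfolding K_def by blast
  then obtain i where i: "i \<in> K" "(\<Prod>j\<in>K - {i}. a j) \<in> I"
    using abs unfolding absorbing_ideal_omit_one K_def by blast
  obtain s where s: "\<And>j. s j \<notin> M i" "\<And>j. \<forall>b\<in>J j. \<exists>d. s j * b = a j * d"
    using a(2)[OF i(1)] by metis
  have "b i j \<in> J j" if "j \<in> K - {i}" for j
    unfolding J_def using that i(1) by (intro ideal.span_base) auto
  then have "\<forall>j\<in>K - {i}. \<exists>d. s j * b i j = a j * d"
    using s(2) by blast
  then obtain d where d: "\<And>j. j \<in> K - {i} \<Longrightarrow> s j * b i j = a j * d j"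
    by metis
  have "(\<Prod>j\<in>K - {i}. s j) * (\<Prod>j\<in>K - {i}. b i j) = (\<Prod>j\<in>K - {i}. d j) * (\<Prod>j\<in>K - {i}. a j)"
    unfolding prod.distrib[symmetric] by (intro prod.cong refl) (simp add: d mult.commute)
  also have "\<dots> \<in> I"
    using i(2) by (rule ideal.subspace_scale[OF sub])
  finally have "(\<Prod>j\<in>K - {i}. s j) \<in> M i"
    by (rule M(2)[OF i(1)])
  then show False
    using prime_ideal_prod[OF maximal_ideal_imp_prime[OF M(1)[OF i(1)]]] s(1) \<open>finite K\<close> by blast
qed


section \<open>Gaussian amount algebras over a Pruefer domain\<close>

lemma ideal_mult_subspace: "ideal.subspace (ideal_mult J K)"
  by (simp add: ideal_mult_def)

lemma ideal_mult_subset_iff: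
  "ideal.subspace I \<Longrightarrow> ideal_mult J K \<subseteq> I \<longleftrightarrow> (\<forall>a\<in>J. \<forall>b\<in>K. a * b \<in> I)"
  using ideal.span_minimal[of "{a * b | a b. a \<in> J \<and> b \<in> K}" I]
    ideal.span_superset[of "{a * b | a b. a \<in> J \<and> b \<in> K}"]
  unfolding ideal_mult_def by blast

lemma absorbing_number_cong:
  assumes "\<And>n. absorbing_ideal n I \<longleftrightarrow> absorbing_ideal n J"
  shows "absorbing_number I = absorbing_number J"
  using assms by (simp add: absorbing_number_def)

context gaussian_amount_algebra
begin

text \<open>Factors can be split off one at a time: \<open>I\<close> contains a product of two ideals iff for each
  element \<open>a\<close> of the first, the colon ideal \<open>(I : a)\<close> contains the second.\<close>

lemma amount_prod_subset_iff:
  assumes "finite X" "ideal.subspace I"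
  shows "A (\<Prod>x\<in>X. f x) \<subseteq> I \<longleftrightarrow> (\<forall>c. (\<forall>x\<in>X. c x \<in> A (f x)) \<longrightarrow> (\<Prod>x\<in>X. c x) \<in> I)"
  using assms
proof (induction X arbitrary: I rule: finite_induct)
  case empty
  then show ?case
    using ideal_one_iff by (auto simp: amount_one)
next
  case (insert x X)
  have upd: "(\<Prod>y\<in>X. (c(x := a)) y) = (\<Prod>y\<in>X. c y)" for c and a :: 'r
    using insert.hyps by (intro prod.cong) auto
  have "A (\<Prod>y\<in>insert x X. f y) \<subseteq> I \<longleftrightarrow> (\<forall>a\<in>A (f x). A (\<Prod>y\<in>X. f y) \<subseteq> {r. r * a \<in> I})"
    using insert by (auto simp: amount_mult ideal_mult_subset_iff mult.commute)
  also have "\<dots> \<longleftrightarrow> (\<forall>a\<in>A (f x). \<forall>c. (\<forall>y\<in>X. c y \<in> A (f y)) \<longrightarrow> (\<Prod>y\<in>X. c y) * a \<in> I)"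
    using insert.IH[OF ideal_colon[OF insert.prems]] by simp
  also have "\<dots> \<longleftrightarrow> (\<forall>c. (\<forall>y\<in>insert x X. c y \<in> A (f y)) \<longrightarrow> (\<Prod>y\<in>insert x X. c y) \<in> I)"
  proof (intro iffI ballI allI impI)
    fix a c
    assume *: "\<forall>c. (\<forall>y\<in>insert x X. c y \<in> A (f y)) \<longrightarrow> (\<Prod>y\<in>insert x X. c y) \<in> I"
      and "a \<in> A (f x)" "\<forall>y\<in>X. c y \<in> A (f y)"
    then have "\<forall>y\<in>insert x X. (c(x := a)) y \<in> A (f y)"
      by auto
    then have "(\<Prod>y\<in>insert x X. (c(x := a)) y) \<in> I"
      using * by blast
    then show "(\<Prod>y\<in>X. c y) * a \<in> I"
      using insert.hyps upd[of c a] by (simp add: mult.commute)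
  qed (use insert.hyps in \<open>auto simp: mult.commute\<close>)
  finally show ?case .
qed

lemma prod_scale_one: "(\<Prod>x\<in>X. r x *s 1) = (\<Prod>x\<in>X. r x) *s 1"
  by (induction X rule: infinite_finite_induct) (auto simp: scale_mult_left)

lemma proper_ideal_eps_iff:
  assumes "ideal.subspace I"
  shows "proper_ideal (eps I) \<longleftrightarrow> proper_ideal I"
proof -
  have "eps I = UNIV \<longleftrightarrow> I = UNIV"
    using assms eps_contraction[OF assms] amount_subset_iff[OF assms] by auto
  then show ?thesis
    using assms eps_ideal by (auto simp: proper_ideal_def)
qed

lemma absorbing_ideal_contraction:
  assumes I: "ideal.subspace I" and abs: "absorbing_ideal n (eps I)"
  shows "absorbing_ideal n I"
proof -
  have contr: "r *s 1 \<in> eps I \<longleftrightarrow> r \<in> I" for r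
    using eps_contraction[OF I] by blast
  have "\<exists>i\<in>{1..n+1}. (\<Prod>j\<in>{1..n+1} - {i}. r j) \<in> I" if "(\<Prod>i\<in>{1..n+1}. r i) \<in> I" for r
  proof -
    have "(\<Prod>i\<in>{1..n+1}. r i *s 1) \<in> eps I"
      using that unfolding prod_scale_one contr .
    then have "\<exists>i\<in>{1..n+1}. (\<Prod>j\<in>{1..n+1} - {i}. r j *s 1) \<in> eps I"
      using abs unfolding absorbing_ideal_omit_one by blast
    then show ?thesis
      unfolding prod_scale_one contr .
  qed
  then show ?thesis
    using abs proper_ideal_eps_iff[OF I] unfolding absorbing_ideal_omit_one by blast
qed

end

lemma absorbing_ideal_extension:
  fixes scale :: "'d::idom \<Rightarrow> 'b::comm_ring_1 \<Rightarrow> 'b"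
  assumes prufer: "prufer_domain TYPE('d)" and gauss: "gaussian_amount_algebra scale A eps"
    and I: "ideal.subspace I" and abs: "absorbing_ideal n I"
  shows "absorbing_ideal n (eps I)"
proof -
  interpret gaussian_amount_algebra scale A eps
    by (rule gauss)
  have "\<exists>i\<in>{1..n+1}. (\<Prod>j\<in>{1..n+1} - {i}. f j) \<in> eps I" if "(\<Prod>i\<in>{1..n+1}. f i) \<in> eps I" for f
  proof -
    have "\<exists>i\<in>{1..n+1}. \<forall>c. (\<forall>j\<in>{1..n+1} - {i}. c j \<in> A (f j)) \<longrightarrow> (\<Prod>j\<in>{1..n+1} - {i}. c j) \<in> I"
    proof (rule prufer_domain_absorbing_ideals[OF prufer abs amount_ideal])
      fix c assume "\<And>j. j \<in> {1..n+1} \<Longrightarrow> c j \<in> A (f j)"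
      then show "(\<Prod>j\<in>{1..n+1}. c j) \<in> I"
        using that unfolding amount_subset_iff[OF I, symmetric]
          amount_prod_subset_iff[OF finite_atLeastAtMost I] by blast
    qed
    then show ?thesis
      unfolding amount_subset_iff[OF I, symmetric]
      by (subst amount_prod_subset_iff[OF _ I]) simp_all
  qed
  then show ?thesis
    using abs proper_ideal_eps_iff[OF I] unfolding absorbing_ideal_omit_one by blast
qed

theorem absorbing_number_extension:
  fixes scale :: "'d::idom \<Rightarrow> 'b::comm_ring_1 \<Rightarrow> 'b"
  assumes "prufer_domain TYPE('d)" "gaussian_amount_algebra scale A eps" "ideal.subspace I"
  shows "absorbing_number (eps I) = absorbing_number I"
  using absorbing_ideal_extension[OF assms]
    gaussian_amount_algebra.absorbing_ideal_contraction[OF assms(2,3)]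
  by (intro absorbing_number_cong) blast


section \<open>Dedekind domains are Pruefer domains\<close>

lemma noetherian_ex_maximal:
  fixes \<A> :: "'a::comm_ring_1 set set"
  assumes noeth: "noetherian TYPE('a)" and "\<A> \<noteq> {}" and sub: "\<And>I. I \<in> \<A> \<Longrightarrow> ideal.subspace I"
  shows "\<exists>M\<in>\<A>. \<forall>X\<in>\<A>. M \<subseteq> X \<longrightarrow> X = M"
proof (rule subset_Zorn_nonempty[OF \<open>\<A> \<noteq> {}\<close>])
  fix \<C> assume C: "\<C> \<noteq> {}" "subset.chain \<A> \<C>"
  then have "ideal.subspace (\<Union>\<C>)"
    using sub by (rule ideal_Union_chain)
  then obtain S where S: "finite S" "\<Union>\<C> = ideal.span S"
    using noeth unfolding noetherian_def fin_gen_ideal_def by blast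
  then have "S \<subseteq> \<Union>\<C>"
    using ideal.span_superset by blast
  then obtain B where B: "B \<in> \<C>" "S \<subseteq> B"
    using finite_subset_Union_chain[OF S(1) _ C] by blast
  then have "B \<in> \<A>"
    using C by (auto simp: subset_chain_def)
  then have "\<Union>\<C> \<subseteq> B"
    using S(2) B(2) sub ideal.span_minimal by metis
  then show "\<Union>\<C> \<in> \<A>"
    using \<open>B \<in> \<A>\<close> B(1) by (metis Union_upper subset_antisym)
qed

text \<open>For a nonzero \<open>a \<in> M\<close>, let \<open>P = (a : b)\<close> be maximal among the colon ideals of \<open>(a)\<close>
  contained in \<open>M\<close>. If \<open>s \<notin> M\<close>, then \<open>(a : s b)\<close> is again contained in \<open>M\<close>, hence equal to \<open>P\<close>.
  This makes \<open>P\<close> prime: if \<open>u v \<in> P\<close> but \<open>v \<notin> P\<close>, then \<open>(a : u b)\<close> is too large to be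
  contained in \<open>M\<close>, so it has an element \<open>s \<notin> M\<close>, and \<open>u \<in> (a : s b) = P\<close>. Being
  nonzero, \<open>P\<close> is maximal, so it equals \<open>M\<close>, and \<open>b / a\<close> is the required fraction.\<close>

lemma dedekind_domain_maximal_inverse:
  fixes M :: "'a::idom set"
  assumes ded: "dedekind_domain TYPE('a)" and M: "maximal_ideal M" and "M \<noteq> {0}"
  shows "\<exists>x\<in>ideal_inverse M. x \<notin> range to_fract"
proof -
  have sub: "ideal.subspace M" and prime: "prime_ideal M"
    using M maximal_ideal_imp_prime by (auto simp: maximal_ideal_def proper_ideal_def)
  obtain a where a: "a \<in> M" "a \<noteq> 0"
    using \<open>M \<noteq> {0}\<close> ideal.subspace_0[OF sub] by blast
  define Q where "Q b = {r. r * b \<in> range ((*) a)}" for b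
  have aD: "ideal.subspace (range ((*) a))"
    using ideal.subspace_span[of "{a}"] by (simp add: ideal.span_singleton mult.commute[of _ a])
  have Qsub: "ideal.subspace (Q b)" for b
    unfolding Q_def using aD by (rule ideal_colon)
  define \<A> where "\<A> = {Q b | b. Q b \<subseteq> M}"
  have "Q 1 \<subseteq> M"
    using a(1) ideal.subspace_scale[OF sub, of a] by (auto simp: Q_def mult.commute)
  then have "\<A> \<noteq> {}"
    by (auto simp: \<A>_def)
  moreover have "ideal.subspace I" if "I \<in> \<A>" for I
    using that Qsub unfolding \<A>_def by blast
  moreover have "noetherian TYPE('a)"
    using ded unfolding dedekind_domain_def by blast
  ultimately obtain P where P: "P \<in> \<A>" "\<And>X. X \<in> \<A> \<Longrightarrow> P \<subseteq> X \<Longrightarrow> X = P"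
    using noetherian_ex_maximal[of \<A>] by blast
  then obtain b where b: "P = Q b" "Q b \<subseteq> M"
    by (auto simp: \<A>_def)
  have mono: "P \<subseteq> Q (s * b)" for s
  proof
    fix r assume "r \<in> P"
    then have "s * (r * b) \<in> range ((*) a)"
      using ideal.subspace_scale[OF aD] unfolding b(1) Q_def by blast
    then show "r \<in> Q (s * b)"
      unfolding Q_def by (simp add: mult.left_commute)
  qed
  have "v \<in> P" if uv: "u * v \<in> P" "u \<notin> P" for u v
  proof (rule ccontr)
    assume "v \<notin> P"
    have stable: "Q (s * b) = P" if "s \<notin> M" for s
    proof (rule P(2))
      have "r \<in> M" if r: "r \<in> Q (s * b)" for r
      proof -
        have "r * s \<in> Q b"
          using r unfolding Q_def by (simp add: mult.assoc)
        then show ?thesis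
          using b(2) prime \<open>s \<notin> M\<close> unfolding prime_ideal_def by blast
      qed
      then show "Q (s * b) \<in> \<A>"
        unfolding \<A>_def by blast
      show "P \<subseteq> Q (s * b)"
        by (rule mono)
    qed
    have "\<not> Q (u * b) \<subseteq> M"
    proof
      assume "Q (u * b) \<subseteq> M"
      then have "Q (u * b) = P"
        using P(2) mono[of u] unfolding \<A>_def by blast
      moreover have "v \<in> Q (u * b)"
        using uv(1) unfolding b(1) Q_def by (simp add: ac_simps)
      ultimately show False
        using \<open>v \<notin> P\<close> by blast
    qed
    then obtain s where s: "s \<in> Q (u * b)" "s \<notin> M"
      by blast
    then have "u \<in> Q (s * b)"
      unfolding Q_def by (simp add: ac_simps)
    then show False
      using stable[OF s(2)] uv(2) by blast
  qed
  moreover have "P \<noteq> UNIV"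
    using b prime_ideal_one[OF prime] by blast
  ultimately have "prime_ideal P"
    using Qsub b(1) unfolding prime_ideal_def proper_ideal_def by blast
  moreover have "a \<in> P"
    unfolding b(1) Q_def by blast
  ultimately have "maximal_ideal P"
    using ded a(2) unfolding dedekind_domain_def by blast
  then have "P = M"
    using b sub M unfolding maximal_ideal_def proper_ideal_def by blast
  have "to_fract b / to_fract a \<in> ideal_inverse M"
  proof -
    have "\<exists>d. r * b = a * d" if "r \<in> M" for r
      using that unfolding \<open>P = M\<close>[symmetric] b(1) Q_def by blast
    then have "to_fract r * (to_fract b / to_fract a) \<in> range to_fract" if "r \<in> M" for r
      using that a(2) by (metis nonzero_mult_div_cancel_left rangeI times_divide_eq_right
        to_fract_eq_0_iff to_fract_mult)
    then show ?thesis
      unfolding ideal_inverse_def by blast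
  qed
  moreover have "to_fract b / to_fract a \<notin> range to_fract"
  proof
    assume "to_fract b / to_fract a \<in> range to_fract"
    then obtain d where "to_fract b / to_fract a = to_fract d"
      by blast
    then have "to_fract b = to_fract (a * d)"
      using a(2) by (simp add: field_simps)
    then have "1 \<in> Q b"
      unfolding Q_def to_fract_eq_iff by (simp, blast)
    then show False
      using b(2) prime_ideal_one[OF prime] by blast
  qed
  ultimately show ?thesis
    by blast
qed

lemma ideal_span_image_atMost:
  fixes e :: "nat \<Rightarrow> 'a::comm_ring_1"
  assumes "y \<in> ideal.span (e ` {..n})"
  shows "\<exists>d. y = (\<Sum>i\<le>n. d i * e i)"
proof -
  \<comment> \<open>\<open>e\<close> need not be injective, so the coefficients are indexed by \<open>{..n}\<close> and not by the
    generators.\<close>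
  define T where "T = range (\<lambda>d. \<Sum>i\<le>n. d i * e i)"
  have "ideal.subspace T"
  proof (rule ideal.subspaceI)
    show "0 \<in> T"
      unfolding T_def by (rule image_eqI[of _ _ "\<lambda>_. 0"]) auto
    show "x + y \<in> T" if xy: "x \<in> T" "y \<in> T" for x y
    proof -
      obtain d d' where "x = (\<Sum>i\<le>n. d i * e i)" "y = (\<Sum>i\<le>n. d' i * e i)"
        using xy unfolding T_def by blast
      then have "x + y = (\<Sum>i\<le>n. (d i + d' i) * e i)"
        by (simp add: sum.distrib distrib_right)
      then show ?thesis
        unfolding T_def by (rule image_eqI[of _ _ "\<lambda>i. d i + d' i"]) auto
    qed
    show "c * x \<in> T" if x: "x \<in> T" for c x
    proof -
      obtain d where "x = (\<Sum>i\<le>n. d i * e i)"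
        using x unfolding T_def by blast
      then have "c * x = (\<Sum>i\<le>n. (c * d i) * e i)"
        by (simp add: sum_distrib_left mult.assoc)
      then show ?thesis
        unfolding T_def by (rule image_eqI[of _ _ "\<lambda>i. c * d i"]) auto
    qed
  qed
  moreover have "e ` {..n} \<subseteq> T"
  proof
    fix y assume "y \<in> e ` {..n}"
    then obtain k where "k \<le> n" "y = e k"
      by blast
    then have "y = (\<Sum>i\<le>n. (if i = k then 1 else 0) * e i)"
      by (simp add: if_distrib[of "\<lambda>x. x * _"] sum.delta cong: if_cong)
    then show "y \<in> T"
      unfolding T_def by (rule image_eqI[of _ _ "\<lambda>i. if i = k then 1 else 0"]) auto
  qed
  ultimately have "y \<in> T"
    using assms ideal.span_minimal by blast
  then show ?thesis
    unfolding T_def by blast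
qed

text \<open>In a Noetherian domain almost integral elements are integral: the ideals generated by
  \<open>c, c x, \<dots>, c x^n\<close> stabilize, so some \<open>c x^(n+1)\<close> is a combination of the earlier ones, and
  dividing by \<open>c\<close> gives an equation of integral dependence. This avoids determinants.\<close>

lemma noetherian_almost_integral:
  fixes x :: "'a::idom fract" and c :: 'a
  assumes noeth: "noetherian TYPE('a)" and ic: "integrally_closed TYPE('a)"
    and "c \<noteq> 0" and pow: "\<And>n. to_fract c * x ^ n \<in> range to_fract"
  shows "x \<in> range to_fract"
proof -
  have "\<forall>n. \<exists>k. to_fract c * x ^ n = to_fract k"
    using pow by blast
  then obtain e where e: "\<And>n. to_fract c * x ^ n = to_fract (e n)"
    by metis
  define U where "U n = ideal.span (e ` {..n})" for n :: nat
  have "\<exists>V\<in>range U. \<forall>X\<in>range U. V \<subseteq> X \<longrightarrow> X = V"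
    using noeth by (rule noetherian_ex_maximal) (auto simp: U_def)
  then obtain n where n: "\<forall>X\<in>range U. U n \<subseteq> X \<longrightarrow> X = U n"
    by (elim bexE imageE) simp
  have "U n \<subseteq> U (Suc n)"
    unfolding U_def by (intro ideal.span_mono image_mono) auto
  then have "U (Suc n) = U n"
    using n by simp
  then have "e (Suc n) \<in> U n"
    using ideal.span_base[of "e (Suc n)" "e ` {..Suc n}"] unfolding U_def by simp
  then obtain d where d: "e (Suc n) = (\<Sum>i\<le>n. d i * e i)"
    using ideal_span_image_atMost unfolding U_def by blast
  have "to_fract c * x ^ Suc n = (\<Sum>i\<le>n. to_fract (d i) * (to_fract c * x ^ i))"
    by (simp only: e d to_fract_sum to_fract_mult)
  also have "\<dots> = to_fract c * (\<Sum>i\<le>n. to_fract (d i) * x ^ i)"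
    by (simp add: sum_distrib_left ac_simps)
  finally have dep: "x ^ Suc n = (\<Sum>i\<le>n. to_fract (d i) * x ^ i)"
    using \<open>c \<noteq> 0\<close> by simp
  \<comment> \<open>The monic polynomial \<open>X^(n+1) - \<Sum>i\<le>n. d i X^i\<close> witnesses integrality.\<close>
  define q where "q = (\<Sum>i\<le>n. monom (d i) i)"
  define p where "p = monom 1 (Suc n) - q"
  have "degree q \<le> n"
    unfolding q_def by (intro degree_sum_le) (auto intro: order.trans[OF degree_monom_le])
  then have "coeff q (Suc n) = 0"
    by (simp add: coeff_eq_0)
  moreover have "degree p = Suc n"
    unfolding p_def using \<open>degree q \<le> n\<close>
    by (subst diff_conv_add_uminus, subst degree_add_eq_left) (auto simp: degree_monom_eq)
  ultimately have "lead_coeff p = 1"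
    by (simp add: p_def)
  have "poly (map_poly to_fract p) x = x ^ Suc n - (\<Sum>i\<le>n. to_fract (d i) * x ^ i)"
  proof -
    have "map_poly to_fract q = (\<Sum>i\<le>n. monom (to_fract (d i)) i)"
      by (rule poly_eqI) (simp add: q_def coeff_map_poly coeff_sum coeff_monom if_distrib[of to_fract] cong: if_cong)
    moreover have "map_poly to_fract p = monom 1 (Suc n) - map_poly to_fract q"
      by (rule poly_eqI) (simp add: p_def coeff_map_poly coeff_monom)
    ultimately show ?thesis
      by (simp add: poly_sum poly_monom)
  qed
  then have "poly (map_poly to_fract p) x = 0"
    using dep by simp
  then show ?thesis
    using ic \<open>lead_coeff p = 1\<close> unfolding integrally_closed_def by blast
qed

text \<open>If the product of \<open>J\<close> and its inverse were contained in a maximal ideal \<open>M\<close>, then any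
  \<open>x\<close> in the inverse of \<open>M\<close> would multiply the inverse of \<open>J\<close> into itself. All powers of \<open>x\<close> would
  therefore have a common denominator, any nonzero element of \<open>J\<close>, so \<open>x\<close> would lie in the ring,
  although \<open>M\<close> has an inverse properly larger than the ring.\<close>

lemma dedekind_domain_invertible:
  fixes J :: "'a::idom set"
  assumes ded: "dedekind_domain TYPE('a)" and J: "ideal.subspace J" "J \<noteq> {0}"
  shows "invertible_ideal J"
proof (rule ccontr)
  define G where "G = {to_fract a * x | a x. a \<in> J \<and> x \<in> ideal_inverse J}"
  define K where "K = {d. to_fract d \<in> fract.span G}"
  have R: "fract.subspace (range to_fract :: 'a fract set)"
  proof (rule fract.subspaceI)
    show "0 \<in> range (to_fract :: 'a \<Rightarrow> _)"
      by (rule image_eqI[of _ _ 0]) simp_all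
  qed (auto simp flip: to_fract_add to_fract_mult)
  have "G \<subseteq> range to_fract"
    unfolding G_def using ideal_inverseD by blast
  then have span: "fract.span G \<subseteq> range to_fract"
    using R by (rule fract.span_minimal)
  have Ksub: "ideal.subspace K"
    unfolding K_def by (rule ideal.subspaceI) (auto intro: fract.span_zero fract.span_add fract.span_scale)
  assume "\<not> invertible_ideal J"
  then have "K \<noteq> UNIV"
    using span unfolding invertible_ideal_def G_def[symmetric] K_def by blast
  then obtain M where M: "maximal_ideal M" "K \<subseteq> M"
    using ex_maximal_ideal_superset Ksub by blast
  have one: "1 \<in> ideal_inverse J"
    unfolding ideal_inverse_def by simp
  obtain c where c: "c \<in> J" "c \<noteq> 0"
    using J ideal.subspace_0 by blast
  have "to_fract c * 1 \<in> G"
    using c(1) one unfolding G_def by blast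
  then have "c \<in> M"
    using M(2) fract.span_base unfolding K_def by auto
  then have "M \<noteq> {0}"
    using c(2) by blast
  then obtain x where x: "x \<in> ideal_inverse M" "x \<notin> range to_fract"
    using dedekind_domain_maximal_inverse[OF ded M(1)] by blast
  have step: "x * y \<in> ideal_inverse J" if y: "y \<in> ideal_inverse J" for y
  proof -
    have "to_fract a * (x * y) \<in> range to_fract" if "a \<in> J" for a
    proof -
      obtain k where k: "to_fract a * y = to_fract k"
        using ideal_inverseD[OF y \<open>a \<in> J\<close>] by blast
      have "to_fract a * y \<in> G"
        using y \<open>a \<in> J\<close> unfolding G_def by blast
      then have "k \<in> M"
        using M(2) fract.span_base[of _ G] k unfolding K_def by auto
      then have "to_fract k * x \<in> range to_fract"
        using ideal_inverseD[OF x(1)] by auto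
      then show ?thesis
        using k by (metis mult.assoc mult.commute)
    qed
    then show ?thesis
      unfolding ideal_inverse_def by blast
  qed
  have "x ^ n \<in> ideal_inverse J" for n
    by (induction n) (simp_all add: one step)
  then have "to_fract c * x ^ n \<in> range to_fract" for n
    using ideal_inverseD[OF _ c(1)] by (metis rangeI)
  moreover have "noetherian TYPE('a)" "integrally_closed TYPE('a)"
    using ded unfolding dedekind_domain_def by blast+
  ultimately have "x \<in> range to_fract"
    using noetherian_almost_integral c(2) by blast
  then show False
    using x(2) by blast
qed

lemma dedekind_domain_imp_prufer:
  "dedekind_domain TYPE('a::idom) \<Longrightarrow> prufer_domain TYPE('a)"
  unfolding prufer_domain_def fin_gen_ideal_def using dedekind_domain_invertible by blast


section \<open>Contents of power series\<close>

definition content_ideal :: "'a::comm_ring_1 fps \<Rightarrow> 'a set" where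
  "content_ideal f = ideal.span (range (fps_nth f))"

lemma content_ideal_subspace: "ideal.subspace (content_ideal f)"
  by (simp add: content_ideal_def)

lemma fps_nth_in_content: "fps_nth f n \<in> content_ideal f"
  by (simp add: content_ideal_def ideal.span_base)

lemma content_ideal_subset_iff:
  assumes "ideal.subspace I"
  shows "content_ideal f \<subseteq> I \<longleftrightarrow> (\<forall>n. fps_nth f n \<in> I)"
proof
  show "\<forall>n. fps_nth f n \<in> I" if "content_ideal f \<subseteq> I"
    using that fps_nth_in_content[of f] by blast
  show "content_ideal f \<subseteq> I" if "\<forall>n. fps_nth f n \<in> I"
    unfolding content_ideal_def using that assms by (intro ideal.span_minimal) auto
qed

lemma content_ideal_0 [simp]: "content_ideal 0 = {0}"
  using content_ideal_subset_iff[of "{0}" 0] ideal.subspace_0[OF content_ideal_subspace[of 0]] by auto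

lemma content_ideal_1 [simp]: "content_ideal (1 :: 'a::comm_ring_1 fps) = UNIV"
  using fps_nth_in_content[of "1 :: 'a fps" 0]
    ideal_one_iff[OF content_ideal_subspace[of "1 :: 'a fps"]] by simp

lemma content_ideal_eq_0D: "content_ideal f = {0} \<Longrightarrow> f = 0"
  using fps_nth_in_content[of f] by (auto simp: fps_eq_iff)

lemma content_ideal_scale:
  fixes r :: "'a::comm_ring_1"
  shows "content_ideal (fps_const r * f) = (\<lambda>a. r * a) ` content_ideal f"
proof -
  have "module_hom ((*) :: 'a \<Rightarrow> 'a \<Rightarrow> 'a) (*) (\<lambda>a. r * a)"
    by unfold_locales (simp_all add: algebra_simps)
  then have "ideal.span ((\<lambda>a. r * a) ` range (fps_nth f)) = (\<lambda>a. r * a) ` content_ideal f"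
    unfolding content_ideal_def by (rule module_hom.span_image)
  then show ?thesis
    unfolding content_ideal_def by (simp add: image_image)
qed

lemma content_ideal_mult_subset:
  "content_ideal (f * g) \<subseteq> ideal_mult (content_ideal f) (content_ideal g)"
proof -
  have sub: "ideal.subspace (ideal_mult (content_ideal f) (content_ideal g))"
    by (rule ideal_mult_subspace)
  have "fps_nth f i * fps_nth g j \<in> ideal_mult (content_ideal f) (content_ideal g)" for i j
    unfolding ideal_mult_def using fps_nth_in_content by (intro ideal.span_base) blast
  then show ?thesis
    unfolding content_ideal_subset_iff[OF sub] fps_mult_nth
    by (auto intro: ideal.subspace_sum[OF sub])
qed

text \<open>Modulo \<open>P\<close>, the lowest nonzero coefficients of \<open>f\<close> and \<open>g\<close> have a nonzero product, and it is
  the lowest coefficient of \<open>f g\<close>.\<close>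

lemma fps_mult_notin_prime:
  fixes f g :: "'a::comm_ring_1 fps"
  assumes P: "prime_ideal P" and f: "\<exists>n. fps_nth f n \<notin> P" and g: "\<exists>n. fps_nth g n \<notin> P"
  shows "\<exists>n. fps_nth (f * g) n \<notin> P"
proof -
  have sub: "ideal.subspace P"
    using P by (auto simp: prime_ideal_def proper_ideal_def)
  define i where "i = (LEAST n. fps_nth f n \<notin> P)"
  define j where "j = (LEAST n. fps_nth g n \<notin> P)"
  have i: "fps_nth f i \<notin> P" "\<And>k. k < i \<Longrightarrow> fps_nth f k \<in> P"
    using LeastI_ex[OF f] not_less_Least[of _ "\<lambda>n. fps_nth f n \<notin> P"] unfolding i_def by blast+
  have j: "fps_nth g j \<notin> P" "\<And>k. k < j \<Longrightarrow> fps_nth g k \<in> P"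
    using LeastI_ex[OF g] not_less_Least[of _ "\<lambda>n. fps_nth g n \<notin> P"] unfolding j_def by blast+
  have rest: "(\<Sum>k\<in>{0..i + j} - {i}. fps_nth f k * fps_nth g (i + j - k)) \<in> P"
  proof (rule ideal.subspace_sum[OF sub])
    fix k assume "k \<in> {0..i + j} - {i}"
    then consider "k < i" | "i + j - k < j"
      by fastforce
    then show "fps_nth f k * fps_nth g (i + j - k) \<in> P"
    proof cases
      case 1
      then show ?thesis
        using ideal.subspace_scale[OF sub i(2)] by (subst mult.commute) blast
    next
      case 2
      then show ?thesis
        using ideal.subspace_scale[OF sub j(2)] by blast
    qed
  qed
  have "fps_nth (f * g) (i + j) = fps_nth f i * fps_nth g j
      + (\<Sum>k\<in>{0..i + j} - {i}. fps_nth f k * fps_nth g (i + j - k))"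
    unfolding fps_mult_nth by (subst sum.remove[of _ i]) auto
  moreover have "fps_nth f i * fps_nth g j \<notin> P"
    using P i(1) j(1) by (auto simp: prime_ideal_def)
  ultimately have "fps_nth (f * g) (i + j) \<notin> P"
    using ideal.subspace_diff[OF sub _ rest] by fastforce
  then show ?thesis
    by blast
qed

text \<open>At a maximal ideal \<open>M\<close> an invertible content becomes principal, and dividing by a generator
  makes the series primitive: multiplication by \<open>x\<close> gives a series over the ring with some
  coefficient outside \<open>M\<close>.\<close>

lemma content_invertible_primitive_multiple:
  fixes f :: "'a::idom fps"
  assumes inv: "invertible_ideal (content_ideal f)" and M: "maximal_ideal M"
  shows "\<exists>x\<in>ideal_inverse (content_ideal f). \<exists>h.
    (\<forall>n. to_fract (fps_nth h n) = to_fract (fps_nth f n) * x) \<and> (\<exists>n. fps_nth h n \<notin> M)"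
proof -
  have sub: "ideal.subspace M"
    using M by (auto simp: maximal_ideal_def proper_ideal_def)
  obtain a x s where axs: "a \<in> content_ideal f" "x \<in> ideal_inverse (content_ideal f)" "s \<notin> M"
      "to_fract a * x = to_fract s"
    using invertible_ideal_unit_at[OF inv M] by blast
  have "\<exists>k. to_fract k = to_fract (fps_nth f n) * x" for n
    using ideal_inverseD[OF axs(2) fps_nth_in_content[of f n]] by metis
  then obtain u where u: "\<And>n. to_fract (u n) = to_fract (fps_nth f n) * x"
    by metis
  have "\<exists>n. u n \<notin> M"
  proof (rule ccontr)
    assume "\<nexists>n. u n \<notin> M"
    \<comment> \<open>If \<open>x\<close> sent all coefficients into \<open>M\<close>, it would send the whole content there, but
      \<open>a x \<notin> M\<close>.\<close>
    define T where "T = {b. \<exists>k\<in>M. to_fract k = to_fract b * x}"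
    have "ideal.subspace T"
    proof (rule ideal.subspaceI)
      show "0 \<in> T"
        using ideal.subspace_0[OF sub] unfolding T_def by force
      show "b + b' \<in> T" if "b \<in> T" "b' \<in> T" for b b'
        using that ideal.subspace_add[OF sub] unfolding T_def
        by (auto simp: distrib_right) (metis to_fract_add)
      show "r * b \<in> T" if "b \<in> T" for r b
        using that ideal.subspace_scale[OF sub] unfolding T_def
        by (auto simp: mult.assoc) (metis to_fract_mult)
    qed
    moreover have "fps_nth f n \<in> T" for n
      using u \<open>\<nexists>n. u n \<notin> M\<close> unfolding T_def by blast
    ultimately have "a \<in> T"
      using axs(1) content_ideal_subset_iff by blast
    then show False
      using axs(3,4) unfolding T_def by auto
  qed
  then show ?thesis
    using u axs(2) by (intro bexI[of _ x] exI[of _ "Abs_fps u"]) simp_all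
qed

text \<open>The argument is local at a maximal ideal \<open>M\<close>. Scale \<open>f\<close> and \<open>g\<close> by \<open>x\<close> and \<open>y\<close> to be primitive
  at \<open>M\<close>. Their product is then primitive too, that is, \<open>x y c \<notin> M\<close> for a coefficient \<open>c\<close> of
  \<open>f g\<close>. Since \<open>(x y c) (a b) = (x a) (y b) c\<close>, this unit at \<open>M\<close> multiplies the product of the
  contents into the content of the product.\<close>

theorem content_ideal_mult:
  fixes f g :: "'a::idom fps"
  assumes f: "invertible_ideal (content_ideal f)" and g: "invertible_ideal (content_ideal g)"
  shows "content_ideal (f * g) = ideal_mult (content_ideal f) (content_ideal g)"
proof (rule antisym[OF content_ideal_mult_subset])
  define C where "C = content_ideal (f * g)"
  have sub: "ideal.subspace C"
    by (simp add: C_def content_ideal_subspace)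
  have "a * b \<in> C" if a: "a \<in> content_ideal f" and b: "b \<in> content_ideal g" for a b
  proof (rule ccontr)
    assume "a * b \<notin> C"
    then have "1 \<notin> {r. r * (a * b) \<in> C}"
      by simp
    then obtain M where M: "maximal_ideal M" "{r. r * (a * b) \<in> C} \<subseteq> M"
      using ex_maximal_ideal_superset[OF ideal_colon[OF sub, of "a * b"]] by blast
    obtain x h where x: "x \<in> ideal_inverse (content_ideal f)"
        "\<And>n. to_fract (fps_nth h n) = to_fract (fps_nth f n) * x" "\<exists>n. fps_nth h n \<notin> M"
      using content_invertible_primitive_multiple[OF f M(1)] by blast
    obtain y k where y: "y \<in> ideal_inverse (content_ideal g)"
        "\<And>n. to_fract (fps_nth k n) = to_fract (fps_nth g n) * y" "\<exists>n. fps_nth k n \<notin> M"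
      using content_invertible_primitive_multiple[OF g M(1)] by blast
    obtain n where n: "fps_nth (h * k) n \<notin> M"
      using fps_mult_notin_prime[OF maximal_ideal_imp_prime[OF M(1)] x(3) y(3)] by blast
    have hk: "to_fract (fps_nth (h * k) n) = to_fract (fps_nth (f * g) n) * (x * y)"
      by (simp add: fps_mult_nth sum_distrib_left x(2) y(2) ac_simps)
    obtain a' where a': "to_fract a * x = to_fract a'"
      using ideal_inverseD[OF x(1) a] by blast
    obtain b' where b': "to_fract b * y = to_fract b'"
      using ideal_inverseD[OF y(1) b] by blast
    have "to_fract (fps_nth (h * k) n * (a * b))
        = (to_fract a * x) * (to_fract b * y) * to_fract (fps_nth (f * g) n)"
      using hk by (simp add: ac_simps)
    also have "\<dots> = to_fract (a' * b' * fps_nth (f * g) n)"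
      by (simp only: a' b' to_fract_mult)
    finally have "fps_nth (h * k) n * (a * b) = a' * b' * fps_nth (f * g) n"
      by (simp only: to_fract_eq_iff)
    also have "\<dots> \<in> C"
      unfolding C_def by (intro ideal.subspace_scale content_ideal_subspace fps_nth_in_content)
    finally show False
      using M(2) n by blast
  qed
  then show "ideal_mult (content_ideal f) (content_ideal g) \<subseteq> content_ideal (f * g)"
    unfolding C_def[symmetric] ideal_mult_subset_iff[OF sub] by blast
qed


section \<open>Polynomials and power series as Gaussian amount algebras\<close>

lemma content_ideal_mult_of_invertible:
  fixes f g :: "'a::idom fps"
  assumes "f \<noteq> 0 \<Longrightarrow> invertible_ideal (content_ideal f)"
    and "g \<noteq> 0 \<Longrightarrow> invertible_ideal (content_ideal g)"
  shows "content_ideal (f * g) = ideal_mult (content_ideal f) (content_ideal g)"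
proof (cases "f = 0 \<or> g = 0")
  case True
  then have "ideal_mult (content_ideal f) (content_ideal g) \<subseteq> {0}"
    by (subst ideal_mult_subset_iff) auto
  then show ?thesis
    using True ideal.span_zero unfolding ideal_mult_def by auto
next
  case False
  then show ?thesis
    using assms content_ideal_mult by blast
qed

text \<open>A multiplicative amount satisfies the exponent condition with both exponents \<open>0\<close>, so it
  remains to compare \<open>A f\<close> with the extended ideals.\<close>

lemma gaussian_amount_algebraI:
  assumes "amount_function scale A"
    and mult: "\<And>f g. A (f * g) = ideal_mult (A f) (A g)"
    and "\<And>I. ideal.subspace I \<Longrightarrow> ideal.subspace (eps I)"
    and "\<And>I f. ideal.subspace I \<Longrightarrow> A f \<subseteq> I \<longleftrightarrow> f \<in> eps I"
    and "\<And>I. ideal.subspace I \<Longrightarrow> {r. scale r 1 \<in> eps I} = I"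
  shows "gaussian_amount_algebra scale A eps"
proof -
  interpret amount_function scale A
    by fact
  have unit: "ideal_mult UNIV J = J" if J: "ideal.subspace J" for J :: "'a set"
  proof
    show "ideal_mult UNIV J \<subseteq> J"
      unfolding ideal_mult_subset_iff[OF J] using ideal.subspace_scale[OF J] by blast
    show "J \<subseteq> ideal_mult UNIV J"
    proof
      fix x assume "x \<in> J"
      then have "1 * x \<in> ideal_mult UNIV J"
        unfolding ideal_mult_def by (intro ideal.span_base) blast
      then show "x \<in> ideal_mult UNIV J"
        by simp
    qed
  qed
  have unit': "ideal_mult J UNIV = J" if "ideal.subspace J" for J :: "'a set"
  proof -
    have "ideal_mult J UNIV = ideal_mult UNIV J"
      unfolding ideal_mult_def by (rule arg_cong[of _ _ ideal.span]) (auto, metis mult.commute, metis mult.commute)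
    then show ?thesis
      using unit[OF that] by simp
  qed
  have "ideal_mult (ideal_mult (ideal_power (A f) 0) (ideal_power (A g) 0)) (A (f * g))
      = ideal_mult (ideal_power (A f) (0 + 1)) (ideal_power (A g) (0 + 1))" for f g
    by (simp add: unit unit' amount_ideal mult ideal_mult_subspace)
  then have "\<exists>m n. ideal_mult (ideal_mult (ideal_power (A f) m) (ideal_power (A g) n)) (A (f * g))
      = ideal_mult (ideal_power (A f) (m + 1)) (ideal_power (A g) (n + 1))" for f g
    by (intro exI)
  then show ?thesis
    by unfold_locales (simp_all only: assms)
qed

lemma gaussian_amount_algebra_fps:
  assumes inv: "\<And>J :: 'a::idom set. ideal.subspace J \<Longrightarrow> J \<noteq> {0} \<Longrightarrow> invertible_ideal J"
  shows "gaussian_amount_algebra (\<lambda>r f :: 'a fps. fps_const r * f) content_ideal fps_ideal"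
proof (rule gaussian_amount_algebraI)
  show "amount_function (\<lambda>r f :: 'a fps. fps_const r * f) content_ideal"
  proof
    fix r s :: 'a and f g :: "'a fps"
    show "fps_const r * (f + g) = fps_const r * f + fps_const r * g"
      by (rule distrib_left)
    show "fps_const (r + s) * f = fps_const r * f + fps_const s * f"
      by (simp add: distrib_right flip: fps_const_add)
    show "fps_const r * (fps_const s * f) = fps_const (r * s) * f"
      by (simp add: mult.assoc flip: fps_const_mult)
    show "fps_const r * f * g = fps_const r * (f * g)"
      by (rule mult.assoc)
  qed (simp_all add: content_ideal_subspace content_ideal_scale content_ideal_mult_subset
    content_ideal_eq_0D)
  show "content_ideal (f * g) = ideal_mult (content_ideal f) (content_ideal g)" for f g :: "'a fps"
    using inv content_ideal_subspace content_ideal_eq_0D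
    by (intro content_ideal_mult_of_invertible) blast+
  fix I :: "'a set" assume I: "ideal.subspace I"
  show "content_ideal f \<subseteq> I \<longleftrightarrow> f \<in> fps_ideal I" for f
    by (simp add: content_ideal_subset_iff[OF I] fps_ideal_def)
  show "ideal.subspace (fps_ideal I)"
    by (rule ideal.subspaceI)
       (auto simp: fps_ideal_def fps_mult_nth ideal.subspace_0[OF I]
         intro!: ideal.subspace_add[OF I] ideal.subspace_sum[OF I] ideal.subspace_scale[OF I])
  show "{r. fps_const r * 1 \<in> fps_ideal I} = I"
    using ideal.subspace_0[OF I] by (auto simp: fps_ideal_def split: if_splits)
qed

text \<open>A polynomial has finitely many nonzero coefficients, so its content is finitely generated and,
  unless it is zero, invertible by the Pruefer property.\<close>

lemma gaussian_amount_algebra_poly: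
  assumes prufer: "prufer_domain TYPE('a::idom)"
  shows "gaussian_amount_algebra (smult :: 'a \<Rightarrow> _) (\<lambda>p. content_ideal (fps_of_poly p)) poly_ideal"
proof (rule gaussian_amount_algebraI)
  have smult: "fps_of_poly (smult r p) = fps_const r * fps_of_poly p" for r and p :: "'a poly"
    by (rule fps_of_poly_smult)
  show "amount_function (smult :: 'a \<Rightarrow> _) (\<lambda>p. content_ideal (fps_of_poly p))"
  proof
    fix p :: "'a poly"
    show "p = 0" if "content_ideal (fps_of_poly p) = {0}"
      using content_ideal_eq_0D[OF that] fps_of_poly_eq_iff[of p 0] by simp
  qed (simp_all add: smult_add_left smult_add_right content_ideal_subspace content_ideal_scale
    content_ideal_mult_subset fps_of_poly_mult smult)
  have "fin_gen_ideal (content_ideal (fps_of_poly p))" for p :: "'a poly"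
  proof -
    have "range (coeff p) \<subseteq> insert 0 (coeff p ` {..degree p})"
      using coeff_eq_0[of p] by (force simp: not_le[symmetric])
    then have "finite (range (coeff p))"
      by (rule finite_subset) auto
    moreover have "range (fps_nth (fps_of_poly p)) = range (coeff p)"
      by simp
    ultimately show ?thesis
      unfolding fin_gen_ideal_def content_ideal_def by metis
  qed
  then have "invertible_ideal (content_ideal (fps_of_poly p))" if "fps_of_poly p \<noteq> 0" for p :: "'a poly"
    using prufer that content_ideal_eq_0D unfolding prufer_domain_def by blast
  then show "content_ideal (fps_of_poly (p * q))
      = ideal_mult (content_ideal (fps_of_poly p)) (content_ideal (fps_of_poly q))" for p q :: "'a poly"
    unfolding fps_of_poly_mult by (intro content_ideal_mult_of_invertible)
  fix I :: "'a set" assume I: "ideal.subspace I"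
  show "content_ideal (fps_of_poly p) \<subseteq> I \<longleftrightarrow> p \<in> poly_ideal I" for p
    by (simp add: content_ideal_subset_iff[OF I] poly_ideal_def)
  show "ideal.subspace (poly_ideal I)"
    by (rule ideal.subspaceI)
       (auto simp: poly_ideal_def coeff_mult ideal.subspace_0[OF I]
         intro!: ideal.subspace_add[OF I] ideal.subspace_sum[OF I] ideal.subspace_scale[OF I])
  show "{r. smult r 1 \<in> poly_ideal I} = I"
    using ideal.subspace_0[OF I] by (auto simp: poly_ideal_def coeff_pCons split: nat.splits)
qed


section \<open>Absorbing numbers of extended ideals\<close>

theorem corollary23:
  fixes scale :: "'d::idom \<Rightarrow> 'b::comm_ring_1 \<Rightarrow> 'b"
    and A :: "'b \<Rightarrow> 'd set"
    and eps :: "'d set \<Rightarrow> 'b set"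
  shows "(prufer_domain TYPE('d) \<and> gaussian_amount_algebra scale A eps \<longrightarrow>
            (\<forall>I :: 'd set. ideal.subspace I \<longrightarrow> absorbing_number (eps I) = absorbing_number I))
       \<and> (dedekind_domain TYPE('e::idom) \<longrightarrow>
            (\<forall>I :: 'e set. ideal.subspace I \<longrightarrow>
               absorbing_number (fps_ideal I) = absorbing_number (poly_ideal I) \<and>
               absorbing_number (poly_ideal I) = absorbing_number I))"
proof (intro conjI impI allI; (elim conjE)?)
  fix I :: "'d set"
  assume "prufer_domain TYPE('d)" "gaussian_amount_algebra scale A eps" "ideal.subspace I"
  then show "absorbing_number (eps I) = absorbing_number I"
    by (rule absorbing_number_extension)
next
  fix I :: "'e set"
  assume ded: "dedekind_domain TYPE('e)" and I: "ideal.subspace I"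
  have prufer: "prufer_domain TYPE('e)"
    using ded by (rule dedekind_domain_imp_prufer)
  show poly: "absorbing_number (poly_ideal I) = absorbing_number I"
    using absorbing_number_extension[OF prufer gaussian_amount_algebra_poly[OF prufer] I] .
  have "absorbing_number (fps_ideal I) = absorbing_number I"
    using absorbing_number_extension[OF prufer
      gaussian_amount_algebra_fps[OF dedekind_domain_invertible[OF ded]] I] .
  then show "absorbing_number (fps_ideal I) = absorbing_number (poly_ideal I)"
    using poly by simp
qed

end
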